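(* Let $n \ge 3$, let $\alpha \in \mathbb{N}^n$, and let $\beta \in \mathbb{N}^n$ lie in the relative interior of $\operatorname{conv}(\Sigma(\alpha))$. Let $\sigma_1,\dots,\sigma_{n+1} \in S_n$ be pairwise distinct permutations and let $\lambda_1,\dots,\lambda_{n+1} \in (0,1)$ be such that $$\beta = \sum_{j=1}^{n+1} \lambda_j\, \sigma_j(\alpha) \quad\text{and}\quad \sum_{j=1}^{n+1} \lambda_j = 1 .$$ Let $b_1,\dots,b_{n+1} \in \mathbb{R}_{\ge 0}$ be arbitrary nonnegative real numbers. Then for every $x = (x_1,\dots,x_n) \in \mathbb{R}_{\ge 0}^n$, $$\sum_{\tau \in S_n} \left(\prod_{j=1}^{n+1} b_j^{\lambda_j}\right) x^{\tau(\beta)} \ \le \ \sum_{\tau \in S_n} \left(\sum_{j=1}^{n+1} b_j \lambda_j\right) x^{\tau(\alpha)} .$$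
   Context: $\mathbb{N}$ contains $0$, and $S_n$ is the symmetric group on $\{1,\dots,n\}$. For $\gamma \in \mathbb{N}^n$ and $\sigma \in S_n$ write $\sigma(\gamma) = (\gamma_{\sigma(1)},\dots,\gamma_{\sigma(n)})$, and let $\Sigma(\gamma) = \{\sigma(\gamma) : \sigma \in S_n\}$ be the set of all vectors obtained by permuting the entries of $\gamma$. For $x \in \mathbb{R}^n_{\ge 0}$, $x^{\tau(\gamma)} = x_1^{\gamma_{\tau(1)}} \cdots x_n^{\gamma_{\tau(n)}}$ (with $0^0 = 1$). The vectors $\sigma_j(\alpha)$ for distinct permutations $\sigma_j$ need not be distinct. *)

theory Defs
  imports "HOL-Analysis.Analysis" "HOL-Combinatorics.Permutations"
begin

text \<open>
  The index set of size \<open>n\<close> is an arbitrary finite type \<open>'n\<close>, so that \<open>n = CARD('n)\<close> and the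
  symmetric group on it is \<open>{\<sigma>. \<sigma> permutes (UNIV :: 'n set)}\<close>.
\<close>

definition permute_vec :: "('n \<Rightarrow> 'n) \<Rightarrow> 'a ^ 'n \<Rightarrow> 'a ^ 'n"
  where "permute_vec \<sigma> \<gamma> = (\<chi> i. \<gamma> $ \<sigma> i)"

definition perm_orbit :: "'a ^ 'n \<Rightarrow> ('a ^ 'n) set"
  where "perm_orbit \<gamma> = {permute_vec \<sigma> \<gamma> | \<sigma>. \<sigma> permutes UNIV}"

definition real_vec :: "nat ^ 'n \<Rightarrow> real ^ 'n"
  where "real_vec \<gamma> = (\<chi> i. real (\<gamma> $ i))"

definition vec_monom :: "real ^ 'n \<Rightarrow> nat ^ 'n \<Rightarrow> real"
  where "vec_monom x \<gamma> = (\<Prod>i\<in>UNIV. (x $ i) ^ (\<gamma> $ i))"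

end

theory Submission
  imports Defs
begin

text \<open>
  For each \<open>\<tau>\<close> the weighted AM-GM inequality with weights \<open>lam j\<close> is applied to the numbers
  \<open>b j * vec_monom x (permute_vec \<tau> (permute_vec (\<sigma> j) \<alpha>))\<close>. Summing over all \<open>\<tau>\<close>, the
  permutation \<open>\<sigma> j\<close> is absorbed by the translation \<open>\<tau> \<mapsto> \<sigma> j \<circ> \<tau>\<close> of the symmetric group.
\<close>

text \<open>A zero among the \<open>y i\<close> kills the product, since
  \<open>0 powr w = 0\<close>. Otherwise this is Jensen's inequality for the convex function
  \<open>exp\<close> at the points \<open>ln (y i)\<close>.\<close>

lemma weighted_arith_geom_mean:
  fixes w y :: "'a \<Rightarrow> real"
  assumes "finite S"
    and w_pos: "\<And>i. i \<in> S \<Longrightarrow> 0 < w i"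
    and w_sum: "(\<Sum>i\<in>S. w i) = 1"
    and y_nonneg: "\<And>i. i \<in> S \<Longrightarrow> 0 \<le> y i"
  shows "(\<Prod>i\<in>S. y i powr w i) \<le> (\<Sum>i\<in>S. w i * y i)"
proof (cases "\<exists>i\<in>S. y i = 0")
  case True
  then have "(\<Prod>i\<in>S. y i powr w i) = 0"
    using \<open>finite S\<close> by (auto simp: prod_zero_iff)
  moreover have "0 \<le> (\<Sum>i\<in>S. w i * y i)"
    using w_pos y_nonneg by (intro sum_nonneg mult_nonneg_nonneg) (auto intro: less_imp_le)
  ultimately show ?thesis by simp
next
  case False
  with y_nonneg have y_pos: "0 < y i" if "i \<in> S" for i
    using that by (metis less_eq_real_def)
  have "S \<noteq> {}" using w_sum by auto
  have "(\<Prod>i\<in>S. y i powr w i) = (\<Prod>i\<in>S. exp (w i * ln (y i)))"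
    using y_pos by (intro prod.cong) (force simp: powr_def)+
  \<comment> \<open>The exponent is written with \<open>*\<^sub>R\<close> to match the convex
    combination in \<open>convex_on_sum\<close>.\<close>
  also have "\<dots> = exp (\<Sum>i\<in>S. w i *\<^sub>R ln (y i))"
    using \<open>finite S\<close> by (simp add: exp_sum)
  also have "\<dots> \<le> (\<Sum>i\<in>S. w i * exp (ln (y i)))"
    using \<open>finite S\<close> \<open>S \<noteq> {}\<close> w_pos w_sum
    by (intro convex_on_sum[OF _ _ exp_convex]) (auto intro: less_imp_le)
  also have "\<dots> = (\<Sum>i\<in>S. w i * y i)"
    using y_pos by (intro sum.cong) auto
  finally show ?thesis .
qed

text \<open>
  Positive weights are needed at \<open>a = 0\<close>, since \<open>0 ^ 0 = 1\<close> but \<open>0 powr 0 = 0\<close>.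
\<close>

lemma power_eq_prod_powr:
  fixes a :: real and w :: "'a \<Rightarrow> real"
  assumes "finite S" "0 \<le> a"
    and w_pos: "\<And>j. j \<in> S \<Longrightarrow> 0 < w j"
    and m: "real m = (\<Sum>j\<in>S. w j * real (k j))"
  shows "a ^ m = (\<Prod>j\<in>S. (a ^ k j) powr w j)"
proof (cases "a = 0")
  case True
  \<comment> \<open>At \<open>a = 0\<close> both sides take only the values 0 and 1, so it suffices
    to compare when they equal 1. As a sum of nonnegative terms with positive weights,
    \<open>m\<close> vanishes exactly when every \<open>k j\<close> does.\<close>
  have "m = 0 \<longleftrightarrow> (\<forall>j\<in>S. w j * real (k j) = 0)"
    using m w_pos \<open>finite S\<close>
    by (subst sum_nonneg_eq_0_iff[symmetric]) (auto simp: less_imp_le)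
  also have "\<dots> \<longleftrightarrow> (\<forall>j\<in>S. k j = 0)"
    using w_pos by force
  finally have m0: "m = 0 \<longleftrightarrow> (\<forall>j\<in>S. k j = 0)" .
  show ?thesis
  proof (cases "m = 0")
    case False
    with m0 obtain j where "j \<in> S" "k j \<noteq> 0" by blast
    with True False \<open>finite S\<close> show ?thesis
      by (auto simp: power_0_left intro!: sym[OF prod_zero])
  qed (use m0 in simp)
next
  case False
  with \<open>0 \<le> a\<close> have "0 < a" by simp
  then have "a ^ m = a powr (\<Sum>j\<in>S. w j * real (k j))"
    by (simp add: powr_realpow flip: m)
  also have "\<dots> = (\<Prod>j\<in>S. a powr (w j * real (k j)))"
    using False by (rule powr_sum)
  also have "\<dots> = (\<Prod>j\<in>S. (a ^ k j) powr w j)"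
    using \<open>0 < a\<close> by (intro prod.cong) (simp_all add: powr_powr mult.commute flip: powr_realpow)
  finally show ?thesis .
qed

text \<open>The order of composition reverses because permutations act on indices: this is a right
  action.\<close>

lemma permute_vec_comp: "permute_vec \<tau> (permute_vec \<sigma> \<gamma>) = permute_vec (\<sigma> \<circ> \<tau>) \<gamma>"
  by (simp add: permute_vec_def vec_eq_iff)

lemma vec_monom_nonneg:
  assumes "\<And>i. 0 \<le> x $ i"
  shows "0 \<le> vec_monom x \<gamma>"
  using assms by (simp add: vec_monom_def prod_nonneg)

text \<open>A convex combination of exponent vectors becomes a weighted geometric mean of monomials,
  the form that AM-GM bounds. It follows from \<open>power_eq_prod_powr\<close> in each variable and
  an exchange of the two products.\<close>

lemma vec_monom_eq_prod_powr:
  fixes \<beta> :: "nat ^ 'n" and \<gamma> :: "'a \<Rightarrow> nat ^ 'n"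
  assumes "finite S" "\<And>i. 0 \<le> x $ i"
    and "\<And>j. j \<in> S \<Longrightarrow> 0 < w j"
    and \<beta>: "real_vec \<beta> = (\<Sum>j\<in>S. w j *\<^sub>R real_vec (\<gamma> j))"
  shows "vec_monom x \<beta> = (\<Prod>j\<in>S. vec_monom x (\<gamma> j) powr w j)"
proof -
  have "real (\<beta> $ i) = (\<Sum>j\<in>S. w j * real (\<gamma> j $ i))" for i
    using arg_cong[OF \<beta>, of "\<lambda>v. v $ i"] by (simp add: real_vec_def)
  then have "vec_monom x \<beta> = (\<Prod>i\<in>UNIV. \<Prod>j\<in>S. ((x $ i) ^ (\<gamma> j $ i)) powr w j)"
    unfolding vec_monom_def using assms by (intro prod.cong power_eq_prod_powr) auto
  also have "\<dots> = (\<Prod>j\<in>S. \<Prod>i\<in>UNIV. ((x $ i) ^ (\<gamma> j $ i)) powr w j)"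
    by (rule prod.swap)
  also have "\<dots> = (\<Prod>j\<in>S. vec_monom x (\<gamma> j) powr w j)"
    by (simp add: vec_monom_def prod_powr_distrib)
  finally show ?thesis .
qed

text \<open>Permuting coordinates is linear, so the same weights serve for every
  \<open>\<tau>\<close>.\<close>

lemma real_vec_permute_sum:
  assumes "real_vec \<beta> = (\<Sum>j\<in>S. w j *\<^sub>R real_vec (\<gamma> j))"
  shows "real_vec (permute_vec \<tau> \<beta>) = (\<Sum>j\<in>S. w j *\<^sub>R real_vec (permute_vec \<tau> (\<gamma> j)))"
proof -
  have "real (\<beta> $ i) = (\<Sum>j\<in>S. w j * real (\<gamma> j $ i))" for i
    using arg_cong[OF assms, of "\<lambda>v. v $ i"] by (simp add: real_vec_def)
  then show ?thesis
    by (simp add: vec_eq_iff real_vec_def permute_vec_def)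
qed

lemma sum_vec_monom_permute:
  fixes \<alpha> :: "nat ^ 'n"
  assumes "\<sigma> permutes UNIV"
  shows "(\<Sum>\<tau> | \<tau> permutes UNIV. vec_monom x (permute_vec \<tau> (permute_vec \<sigma> \<alpha>)))
       = (\<Sum>\<tau> | \<tau> permutes UNIV. vec_monom x (permute_vec \<tau> \<alpha>))"
  unfolding permute_vec_comp by (rule setum_permutations_compose_left[OF assms, symmetric])

theorem lemma3p1:
  fixes \<alpha> \<beta> :: "nat ^ 'n"
    and \<sigma> :: "nat \<Rightarrow> 'n \<Rightarrow> 'n"
    and lam b :: "nat \<Rightarrow> real"
    and x :: "real ^ 'n"
  assumes "CARD('n) \<ge> 3"
    and "real_vec \<beta> \<in> rel_interior (convex hull (real_vec ` perm_orbit \<alpha>))"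
    and "\<And>j. j \<in> {1..CARD('n) + 1} \<Longrightarrow> \<sigma> j permutes UNIV"
    and "inj_on \<sigma> {1..CARD('n) + 1}"
    and "\<And>j. j \<in> {1..CARD('n) + 1} \<Longrightarrow> lam j \<in> {0<..<1}"
    and "real_vec \<beta> = (\<Sum>j = 1..CARD('n) + 1. lam j *\<^sub>R real_vec (permute_vec (\<sigma> j) \<alpha>))"
    and "(\<Sum>j = 1..CARD('n) + 1. lam j) = 1"
    and "\<And>j. j \<in> {1..CARD('n) + 1} \<Longrightarrow> b j \<ge> 0"
    and "\<And>i. x $ i \<ge> 0"
  shows "(\<Sum>\<tau> | \<tau> permutes (UNIV :: 'n set).
            (\<Prod>j = 1..CARD('n) + 1. b j powr lam j) * vec_monom x (permute_vec \<tau> \<beta>))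
       \<le> (\<Sum>\<tau> | \<tau> permutes (UNIV :: 'n set).
            (\<Sum>j = 1..CARD('n) + 1. b j * lam j) * vec_monom x (permute_vec \<tau> \<alpha>))"
proof -
  let ?J = "{1..CARD('n) + 1}" and ?P = "{\<tau>. \<tau> permutes (UNIV :: 'n set)}"
  let ?y = "\<lambda>\<tau> j. vec_monom x (permute_vec \<tau> (permute_vec (\<sigma> j) \<alpha>))"
  \<comment> \<open>Strict positivity lets the monomial identity cover points \<open>x\<close> with
    zero coordinates.\<close>
  have lam: "0 < lam j" if "j \<in> ?J" for j
    using assms(5)[OF that] by simp
  have "(\<Prod>j\<in>?J. b j powr lam j) * vec_monom x (permute_vec \<tau> \<beta>)
      \<le> (\<Sum>j\<in>?J. b j * lam j * ?y \<tau> j)" for \<tau>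
  proof -
    have "vec_monom x (permute_vec \<tau> \<beta>) = (\<Prod>j\<in>?J. ?y \<tau> j powr lam j)"
      by (rule vec_monom_eq_prod_powr[OF _ assms(9) lam real_vec_permute_sum[OF assms(6)]]) auto
    then have "(\<Prod>j\<in>?J. b j powr lam j) * vec_monom x (permute_vec \<tau> \<beta>)
        = (\<Prod>j\<in>?J. (b j * ?y \<tau> j) powr lam j)"
      by (simp only: powr_mult prod.distrib)
    also have "\<dots> \<le> (\<Sum>j\<in>?J. lam j * (b j * ?y \<tau> j))"
      using assms(7,8,9) lam
      by (intro weighted_arith_geom_mean mult_nonneg_nonneg vec_monom_nonneg) blast+
    finally show ?thesis by (simp only: mult_ac)
  qed
  then have "(\<Sum>\<tau>\<in>?P. (\<Prod>j\<in>?J. b j powr lam j) * vec_monom x (permute_vec \<tau> \<beta>))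
      \<le> (\<Sum>\<tau>\<in>?P. \<Sum>j\<in>?J. b j * lam j * ?y \<tau> j)"
    by (rule sum_mono)
  also have "\<dots> = (\<Sum>j\<in>?J. b j * lam j * (\<Sum>\<tau>\<in>?P. ?y \<tau> j))"
    by (subst sum.swap) (simp only: sum_distrib_left)
  \<comment> \<open>After the exchange of sums, each inner sum runs over the whole group, so it does
    not depend on \<open>j\<close> and factors out.\<close>
  also have "\<dots> = (\<Sum>j\<in>?J. b j * lam j * (\<Sum>\<tau>\<in>?P. vec_monom x (permute_vec \<tau> \<alpha>)))"
    by (intro sum.cong refl arg_cong2[where f = "(*)"] sum_vec_monom_permute assms(3))
  also have "\<dots> = (\<Sum>\<tau>\<in>?P. (\<Sum>j\<in>?J. b j * lam j) * vec_monom x (permute_vec \<tau> \<alpha>))"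
    by (simp only: sum_distrib_left sum_distrib_right sum.swap[of _ ?J])
  finally show ?thesis .
qed

end
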